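(* Let $T\in\mathbb{B}(\mathcal{H})$. If $s,t\in \mathcal{PQ}(T)$ are coprime with $s>t$, then $T$ is $n$-power quasinormal for every positive integer $n\ge t$.
   Context: $\mathbb{N}$ denotes the positive integers. $\mathbb{B}(\mathcal{H})$ is the algebra of bounded linear operators on a complex Hilbert space $\mathcal{H}$. Write $[S,T]=ST-TS$. For $n\in\mathbb{N}$, $T$ is $n$-power quasinormal if $[T^n,T^*T]=0$. The power-quasinormality index set of $T$ is $\mathcal{PQ}(T)=\{n\in\mathbb{N}:[T^n,T^\ast T]=0\}$. *)

theory Defs
  imports "HOL-Analysis.Analysis"
begin

class complex_vector = real_vector +
  fixes scaleC :: "complex \<Rightarrow> 'a \<Rightarrow> 'a" (infixr "*\<^sub>C" 75)
  assumes scaleC_add_right: "c *\<^sub>C (x + y) = c *\<^sub>C x + c *\<^sub>C y"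
    and scaleC_add_left: "(c + d) *\<^sub>C x = c *\<^sub>C x + d *\<^sub>C x"
    and scaleC_scaleC: "c *\<^sub>C d *\<^sub>C x = (c * d) *\<^sub>C x"
    and scaleC_one: "1 *\<^sub>C x = x"
    and scaleR_eq_scaleC: "r *\<^sub>R x = complex_of_real r *\<^sub>C x"

text \<open>
  The inner product is linear in the first argument. Its real part is the real inner
  product of the underlying real space, so that the norm, and with it the topology, is
  the one given by the square root of \<open>cinner x x\<close>; positive definiteness is inherited
  from \<^class>\<open>real_inner\<close>.
\<close>

class complex_inner = complex_vector + real_inner +
  fixes cinner :: "'a \<Rightarrow> 'a \<Rightarrow> complex"
  assumes cinner_commute: "cinner x y = cnj (cinner y x)"
    and cinner_add_left: "cinner (x + y) z = cinner x z + cinner y z"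
    and cinner_scaleC_left: "cinner (c *\<^sub>C x) y = c * cinner x y"
    and inner_eq_Re_cinner: "inner x y = Re (cinner x y)"

class chilbert_space = complex_inner + complete_space

definition bounded_clinear :: "('a::complex_inner \<Rightarrow> 'b::complex_inner) \<Rightarrow> bool" where
  "bounded_clinear T \<longleftrightarrow> bounded_linear T \<and> (\<forall>c x. T (c *\<^sub>C x) = c *\<^sub>C T x)"

text \<open>
  For a bounded operator on a Hilbert space the adjoint exists and is unique (Riesz);
  for other functions the value is unspecified.
\<close>

definition cadjoint :: "('a::chilbert_space \<Rightarrow> 'a) \<Rightarrow> 'a \<Rightarrow> 'a" where
  "cadjoint T = (THE S. \<forall>x y. cinner (T x) y = cinner x (S y))"

definition commutator :: "('a::ab_group_add \<Rightarrow> 'a) \<Rightarrow> ('a \<Rightarrow> 'a) \<Rightarrow> 'a \<Rightarrow> 'a" where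
  "commutator S T = (\<lambda>x. (S \<circ> T) x - (T \<circ> S) x)"

definition power_quasinormal :: "nat \<Rightarrow> ('a::chilbert_space \<Rightarrow> 'a) \<Rightarrow> bool" where
  "power_quasinormal n T \<longleftrightarrow> commutator (T ^^ n) (cadjoint T \<circ> T) = (\<lambda>x. 0)"

definition PQ :: "('a::chilbert_space \<Rightarrow> 'a) \<Rightarrow> nat set" where
  "PQ T = {n. 0 < n \<and> commutator (T ^^ n) (cadjoint T \<circ> T) = (\<lambda>x. 0)}"

end

theory Submission imports Defs begin

text \<open>
  Put \<open>A = T\<^sup>* T\<close>. The argument has two ingredients.

  Kernel stabilisation: if \<open>t > 0\<close> and \<open>T^t\<close> commutes with \<open>A\<close>, then
  \<open>ker T^m \<subseteq> ker T^t\<close> for every \<open>m\<close> (lemma \<open>ker_funpow_subset\<close>). It is enough to show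
  this for \<open>m = t + 1\<close>. If \<open>T^(t+1) x = 0\<close> and \<open>b = (T\<^sup>*)^t T^t x\<close>, then
  \<open>\<parallel>T b\<parallel>\<^sup>2 = \<langle>T^t x, T^t A b\<rangle> = \<langle>T^t x, A T^t b\<rangle> = \<langle>T^(t+1) x, T^(t+1) b\<rangle> = 0\<close>. So
  \<open>T^t b = 0\<close>, whence \<open>\<parallel>b\<parallel>\<^sup>2 = \<langle>T^t b, T^t x\<rangle> = 0\<close> and
  \<open>\<parallel>T^t x\<parallel>\<^sup>2 = \<langle>b, x\<rangle> = 0\<close>.

  Arithmetic: for \<open>n \<ge> t\<close>, the commutator \<open>[T^n, A]\<close> equals \<open>T^t [T^(n-t), A]\<close>, so its values
  have the form \<open>T^t y\<close>. Since \<open>s\<close> and \<open>t\<close> are coprime, some \<open>n + t j\<close> is a multiple of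
  \<open>s\<close>; then \<open>T^(t j) [T^n, A] = [T^(n + t j), A] = 0\<close>. Therefore
  \<open>T^(t j + t) y = 0\<close>, and stabilisation gives \<open>T^t y = 0\<close>.

  The adjoint itself is obtained from the Riesz representation theorem, proved here by minimising
  the quadratic functional \<open>\<parallel>x\<parallel>\<^sup>2 - 2 f x\<close>.
\<close>

section \<open>Riesz representation and the adjoint\<close>

theorem riesz_representation_real:
  fixes f :: "'a::{real_inner,complete_space} \<Rightarrow> real"
  assumes "bounded_linear f"
  obtains u where "\<And>v. f v = inner u v"
proof -
  interpret f: bounded_linear f by fact
  define J where "J x = inner x x - 2 * f x" for x
  obtain K where K: "\<And>x. norm (f x) \<le> norm x * K"
    using f.bounded by blast
  have "- K\<^sup>2 \<le> J x" for x
  proof -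
    have "f x \<le> norm x * K" using K[of x] by simp
    moreover have "0 \<le> (norm x - K)\<^sup>2" by simp
    ultimately show ?thesis
      by (simp add: J_def power2_norm_eq_inner[symmetric] power2_diff)
  qed
  hence bdd: "bdd_below (range J)" by (auto intro!: bdd_belowI)
  define m where "m = Inf (range J)"
  have m_le: "m \<le> J x" for x
    unfolding m_def by (rule cInf_lower[OF _ bdd]) simp
  have "\<exists>x. J x < m + inverse (real (Suc k))" for k
  proof -
    have "Inf (range J) < m + inverse (real (Suc k))" by (simp add: m_def)
    thus ?thesis using cInf_lessD[of "range J"] by auto
  qed
  then obtain X where X: "\<And>k. J (X k) < m + inverse (real (Suc k))" by metis
  have parallelogram: "(norm (x - y))\<^sup>2 = 2 * J x + 2 * J y - 4 * J ((1/2) *\<^sub>R (x + y))" for x y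
    by (simp add: J_def f.add f.scaleR power2_norm_eq_inner inner_add_left inner_add_right
        inner_diff_left inner_diff_right inner_commute[of y x] field_simps)
  have "Cauchy X"
  proof (rule metric_CauchyI)
    fix e :: real assume e: "0 < e"
    then obtain N where N: "inverse (real (Suc N)) < e\<^sup>2 / 4"
      using reals_Archimedean[of "e\<^sup>2 / 4"] by auto
    have "dist (X p) (X q) < e" if "N \<le> p" "N \<le> q" for p q
    proof -
      have "inverse (real (Suc p)) \<le> inverse (real (Suc N))"
        "inverse (real (Suc q)) \<le> inverse (real (Suc N))"
        using that by (auto intro!: le_imp_inverse_le)
      hence "(norm (X p - X q))\<^sup>2 < e\<^sup>2"
        using parallelogram[of "X p" "X q"] X[of p] X[of q] N
          m_le[of "(1/2) *\<^sub>R (X p + X q)"] by linarith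
      thus ?thesis using e by (simp add: dist_norm power2_less_imp_less)
    qed
    thus "\<exists>M. \<forall>p\<ge>M. \<forall>q\<ge>M. dist (X p) (X q) < e" by blast
  qed
  then obtain u where u: "X \<longlonglongrightarrow> u"
    using Cauchy_convergent convergent_def by blast
  have "(\<lambda>k. J (X k)) \<longlonglongrightarrow> J u"
    unfolding J_def by (intro tendsto_intros u f.tendsto)
  moreover have "(\<lambda>k. m + inverse (real (Suc k))) \<longlonglongrightarrow> m"
    by (rule LIMSEQ_inverse_real_of_nat_add)
  ultimately have Ju: "J u \<le> m"
    by (rule LIMSEQ_le) (use X less_imp_le in blast)
  have "f v = inner u v" for v
  proof (cases "v = 0")
    case True
    thus ?thesis by (simp add: f.zero)
  next
    case False
    define d where "d = inner u v - f v"
    define r where "r = - d / inner v v"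
    have v: "inner v v > 0" using False by simp
    \<comment> \<open>This \<open>r\<close> minimises \<open>J (u + r *\<^sub>R v)\<close> over the line through \<open>u\<close> in direction \<open>v\<close>.\<close>
    have "J (u + r *\<^sub>R v) = J u + 2 * r * d + r * r * inner v v"
      by (simp add: J_def d_def f.add f.scaleR inner_add_left inner_add_right
          inner_commute[of v u] algebra_simps)
    moreover have "2 * r * d + r * r * inner v v = - (d\<^sup>2 / inner v v)"
      using v by (simp add: r_def power2_eq_square field_simps)
    ultimately have "d\<^sup>2 / inner v v \<le> 0"
      using m_le[of "u + r *\<^sub>R v"] Ju by linarith
    hence "d = 0" using v by (simp add: divide_le_0_iff)
    thus ?thesis by (simp add: d_def)
  qed
  thus thesis by (rule that)
qed

lemma cinner_eq_zero_iff: "cinner x x = 0 \<longleftrightarrow> x = (0::'a::complex_inner)"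
proof
  assume "cinner x x = 0"
  hence "inner x x = 0" by (simp add: inner_eq_Re_cinner)
  thus "x = 0" by simp
next
  assume "x = 0"
  thus "cinner x x = 0" using cinner_add_left[of x x x] by simp
qed

lemma cinner_zero_left: "cinner 0 (y::'a::complex_inner) = 0"
  using cinner_add_left[of 0 0 y] by simp

lemma Im_cinner_eq_inner: "Im (cinner x y) = - inner (\<i> *\<^sub>C x) (y::'a::complex_inner)"
  by (simp add: inner_eq_Re_cinner cinner_scaleC_left)

text \<open>
  Riesz representation on the underlying real space gives an adjoint for the real part of the
  inner product; complex linearity of \<open>T\<close> carries the identity over to the imaginary part.
\<close>

lemma cinner_cadjoint:
  fixes T :: "'a::chilbert_space \<Rightarrow> 'a"
  assumes "bounded_clinear T"
  shows "cinner (T x) y = cinner x (cadjoint T y)"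
proof -
  have T: "bounded_linear T" and TC: "\<And>c x. T (c *\<^sub>C x) = c *\<^sub>C T x"
    using assms by (auto simp: bounded_clinear_def)
  have "\<exists>u. \<forall>x. inner (T x) y = inner x u" for y
  proof -
    have "bounded_linear (\<lambda>x. inner (T x) y)"
      using bounded_linear_compose[OF bounded_linear_inner_left T] .
    then obtain u where "\<And>x. inner (T x) y = inner u x"
      by (rule riesz_representation_real) blast
    hence "\<forall>x. inner (T x) y = inner x u" by (simp add: inner_commute)
    thus ?thesis ..
  qed
  then obtain S where S: "\<And>x y. inner (T x) y = inner x (S y)" by metis
  have adj: "cinner (T x) y = cinner x (S y)" for x y
  proof (rule complex_eqI)
    show "Re (cinner (T x) y) = Re (cinner x (S y))"
      using S[of x y] by (simp add: inner_eq_Re_cinner)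
    show "Im (cinner (T x) y) = Im (cinner x (S y))"
      using S[of "\<i> *\<^sub>C x" y] by (simp only: Im_cinner_eq_inner TC)
  qed
  have "cadjoint T = S"
    unfolding cadjoint_def
  proof (rule the_equality)
    fix S' assume S': "\<forall>x y. cinner (T x) y = cinner x (S' y)"
    show "S' = S"
    proof
      fix y
      have "inner x (S' y) = inner x (S y)" for x
        using S' adj by (simp add: inner_eq_Re_cinner)
      thus "S' y = S y" using vector_eq_ldot[of "S' y" "S y"] by blast
    qed
  qed (simp add: adj)
  thus ?thesis by (simp add: adj)
qed

section \<open>Stabilisation of kernels\<close>

lemma cinner_funpow_adjoint:
  fixes T S :: "'a::complex_inner \<Rightarrow> 'a"
  assumes "\<And>x y. cinner (T x) y = cinner x (S y)"
  shows "cinner ((T ^^ k) x) y = cinner x ((S ^^ k) y)"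
  by (induction k arbitrary: x) (simp_all add: assms funpow_swap1)

lemma linear_funpow: "linear T \<Longrightarrow> linear ((T :: 'a::real_vector \<Rightarrow> 'a) ^^ k)"
  by (induction k) (simp_all add: linear_id linear_compose)

lemma ker_funpow_Suc_subset:
  fixes T S :: "'a::complex_inner \<Rightarrow> 'a"
  assumes "linear T"
    and adj: "\<And>x y. cinner (T x) y = cinner x (S y)"
    and comm: "\<And>x. (T ^^ t) (S (T x)) = S (T ((T ^^ t) x))"
    and "t > 0" and ker: "(T ^^ Suc t) x = 0"
  shows "(T ^^ t) x = 0"
proof -
  note adjt = cinner_funpow_adjoint[of T S, OF adj]
  have adj': "cinner (S x) y = cinner x (T y)" for x y
    by (metis adj cinner_commute)
  have adjt': "cinner ((S ^^ k) x) y = cinner x ((T ^^ k) y)" for k x y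
    using cinner_funpow_adjoint[of S T, OF adj'] .
  define b where "b = (S ^^ t) ((T ^^ t) x)"
  have "cinner (T b) (T b) = cinner b (S (T b))"
    by (rule adj)
  also have "\<dots> = cinner ((T ^^ t) x) ((T ^^ t) (S (T b)))"
    by (subst (1) b_def) (rule adjt')
  also have "\<dots> = cinner ((T ^^ Suc t) x) (T ((T ^^ t) b))"
    by (simp add: comm adj)
  also have "\<dots> = 0"
    using ker by (simp add: cinner_zero_left)
  finally have "T b = 0"
    by (simp add: cinner_eq_zero_iff)
  obtain k where "t = Suc k"
    using \<open>t > 0\<close> gr0_implies_Suc by blast
  hence "(T ^^ t) b = 0"
    using \<open>T b = 0\<close> linear_0[OF linear_funpow[OF \<open>linear T\<close>, of k]]
    by (simp add: funpow_swap1)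
  hence "cinner b b = 0"
    using adjt[of t b "(T ^^ t) x"] by (simp add: b_def cinner_zero_left)
  hence "b = 0"
    by (simp add: cinner_eq_zero_iff)
  hence "cinner ((T ^^ t) x) ((T ^^ t) x) = 0"
    using adjt'[of t "(T ^^ t) x" x] by (simp add: b_def cinner_zero_left)
  thus ?thesis
    by (simp add: cinner_eq_zero_iff)
qed

lemma ker_funpow_subset:
  fixes T S :: "'a::complex_inner \<Rightarrow> 'a"
  assumes "linear T"
    and "\<And>x y. cinner (T x) y = cinner x (S y)"
    and "\<And>x. (T ^^ t) (S (T x)) = S (T ((T ^^ t) x))"
    and "t > 0" and "(T ^^ (k + t)) x = 0"
  shows "(T ^^ t) x = 0"
  using assms(5)
proof (induction k arbitrary: x)
  case (Suc k)
  have "(T ^^ (k + t)) (T x) = 0"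
    using Suc.prems by (simp add: funpow_swap1)
  hence "(T ^^ Suc t) x = 0"
    using Suc.IH[of "T x"] by (simp add: funpow_swap1)
  thus ?case
    by (rule ker_funpow_Suc_subset[where T = T and S = S and t = t, OF assms(1-4)])
qed simp

section \<open>Commutation of large powers\<close>

lemma funpow_mult_commute:
  assumes "\<And>x. (T ^^ k) (A x) = A ((T ^^ k) x)"
  shows "(T ^^ (k * i)) (A x) = A ((T ^^ (k * i)) x)"
  by (induction i) (simp_all add: funpow_add assms)

lemma mem_PQ_iff:
  "k \<in> PQ T \<longleftrightarrow> 0 < k \<and> (\<forall>x. (T ^^ k) (cadjoint T (T x)) = cadjoint T (T ((T ^^ k) x)))"
  by (simp add: PQ_def commutator_def fun_eq_iff)

theorem corollary3p6:
  fixes T :: "'a::chilbert_space \<Rightarrow> 'a" and s t n :: nat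
  assumes "bounded_clinear T"
    and "s \<in> PQ T" and "t \<in> PQ T"
    and "coprime s t" and "s > t"
    and "n > 0" and "n \<ge> t"
  shows "power_quasinormal n T"
proof -
  define A where "A x = cadjoint T (T x)" for x
  have comm_s: "(T ^^ s) (A x) = A ((T ^^ s) x)"
    and comm_t: "(T ^^ t) (A x) = A ((T ^^ t) x)" for x
    using assms(2,3) by (simp_all add: mem_PQ_iff A_def)
  have pos: "s > 0" "t > 0"
    using assms(2,3) by (simp_all add: mem_PQ_iff)
  have lin: "linear T"
    using assms(1) by (simp add: bounded_clinear_def bounded_linear.linear)
  obtain p q where pq: "s * p = t * q + 1"
    using bezout_nat[of s t] pos \<open>coprime s t\<close> by auto
  \<comment> \<open>Scaling the Bezout relation by \<open>n\<close> exhibits \<open>n + t j\<close>, with \<open>j = q n\<close>, as a multiple of \<open>s\<close>.\<close>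
  define j where "j = q * n"
  have sum: "s * (p * n) = t * j + t + (n - t)"
    using arg_cong[OF pq, of "\<lambda>a. a * n"] \<open>n \<ge> t\<close> by (simp add: j_def algebra_simps)
  have "(T ^^ n) (A x) = A ((T ^^ n) x)" for x
  proof -
    define y where "y = (T ^^ (n - t)) (A x) - A ((T ^^ (n - t)) x)"
    have diff: "(T ^^ k) y = (T ^^ (k + (n - t))) (A x) - A ((T ^^ (k + (n - t))) x)"
      if "\<And>z. (T ^^ k) (A z) = A ((T ^^ k) z)" for k
      by (simp add: y_def linear_diff[OF linear_funpow[OF lin]] that funpow_add)
    have "(T ^^ (t * j + t)) (A z) = A ((T ^^ (t * j + t)) z)" for z
      using funpow_mult_commute[of t T A "Suc j" z, OF comm_t] by (simp add: add.commute)
    hence "(T ^^ (t * j + t)) y = 0"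
      using diff[of "t * j + t"] funpow_mult_commute[of s T A "p * n" x, OF comm_s]
      by (simp only: sum) simp
    hence "(T ^^ t) y = 0"
      by (rule ker_funpow_subset[where T = T and S = "cadjoint T" and t = t and k = "t * j",
            OF lin cinner_cadjoint[OF assms(1)] comm_t[unfolded A_def] pos(2)])
    thus ?thesis
      using diff[OF comm_t] \<open>n \<ge> t\<close> by simp
  qed
  thus ?thesis
    by (simp add: power_quasinormal_def commutator_def A_def)
qed

end
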